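(* Let $\theta>0$, $0\le\alpha<1$ and $n\ge1$. Let $p(j)$ denote the number of integer partitions of $j$. Then the eigenvalues of the down-up walk $UD_n$ on the $n$th level of the Kingman lattice with parameters $\theta,\alpha$ are $$1-\frac{i(\theta+i-1)}{n(\theta+n-1)}\quad\text{with multiplicity } p(i)-p(i-1)\qquad(0\le i\le n).$$
   Context: Conventions: $p(0)=1$, $p(-1)=0$. For a partition $\lambda$, $m_k(\lambda)$ is the number of parts (rows) of size $k$ and $l(\lambda)$ the number of parts. Down chain: from a partition $\lambda$ of $n$, for each $j\ge1$ with $m_j(\lambda)>0$, remove a box from a row of length $j$ (i.e. replace a part $j$ by $j-1$) with probability $\frac{j\,m_j(\lambda)}{n}$, obtaining a partition of $n-1$. Up chain: from a partition $\lambda$ of $n$, for each $k\ge1$ add a box to a row of length $k$ (replace a part $k$ by $k+1$) with probability $\frac{(k-\alpha)m_k(\lambda)}{\theta+n}$, and add a new part of size $1$ with probability $\frac{\theta+\alpha l(\lambda)}{\theta+n}$, obtaining a partition of $n+1$. $D_n$ (resp. $U_n$) is the linear operator on the complex vector space with basis the partitions of $n$ which sends $\lambda$ to the linear combination of partitions of $n-1$ (resp. $n+1$) whose coefficients are the down (resp. up) transition probabilities from $\lambda$. The down-up walk on the partitions of $n$ takes one down step and then one up step; it is given by $UD_n=U_{n-1}D_n$. *)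

theory Defs
  imports Complex_Main "HOL-Library.Multiset" "Jordan_Normal_Form.Char_Poly"
begin

text \<open>A partition is the multiset of its (positive) parts, so \<open>m\<^sub>k(\<lambda>)\<close> is \<^term>\<open>count lam k\<close>,
  \<open>l(\<lambda>)\<close> is \<^term>\<open>size lam\<close>, and the number partitioned is \<^term>\<open>sum_mset lam\<close>.\<close>

definition partitions :: "nat \<Rightarrow> nat multiset set" where
  "partitions n = {lam. 0 \<notin># lam \<and> sum_mset lam = n}"

text \<open>Defined on \<^typ>\<open>int\<close> because \<open>p(-1) = 0\<close> is used; the values are integers so that
  differences do not truncate.\<close>

definition num_partitions :: "int \<Rightarrow> int" where
  "num_partitions j = (if j < 0 then 0 else int (card (partitions (nat j))))"

definition remove_box :: "nat \<Rightarrow> nat multiset \<Rightarrow> nat multiset" where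
  "remove_box j lam = lam - {#j#} + (if j = 1 then {#} else {#j - 1#})"

definition add_box :: "nat \<Rightarrow> nat multiset \<Rightarrow> nat multiset" where
  "add_box k lam = lam - {#k#} + {#k + 1#}"

definition down_prob :: "nat multiset \<Rightarrow> nat multiset \<Rightarrow> real" where
  "down_prob lam mu =
     (\<Sum>j | j \<in># lam \<and> remove_box j lam = mu. real j * real (count lam j) / real (sum_mset lam))"

definition up_prob :: "real \<Rightarrow> real \<Rightarrow> nat multiset \<Rightarrow> nat multiset \<Rightarrow> real" where
  "up_prob \<theta> \<alpha> lam mu =
     (\<Sum>k | k \<in># lam \<and> add_box k lam = mu.
        (real k - \<alpha>) * real (count lam k) / (\<theta> + real (sum_mset lam)))
     + (if mu = add_mset 1 lam
        then (\<theta> + \<alpha> * real (size lam)) / (\<theta> + real (sum_mset lam)) else 0)"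

text \<open>A vector \<open>\<Sum> c\<^sub>\<lambda> \<lambda>\<close> of the complex space with basis \<^term>\<open>partitions n\<close> is represented by its
  coefficient function \<open>\<lambda> \<mapsto> c\<^sub>\<lambda>\<close>, which vanishes outside \<^term>\<open>partitions n\<close>.\<close>

definition basis_vec :: "nat multiset \<Rightarrow> nat multiset \<Rightarrow> complex" where
  "basis_vec lam = (\<lambda>mu. if mu = lam then 1 else 0)"

definition D_op :: "nat \<Rightarrow> (nat multiset \<Rightarrow> complex) \<Rightarrow> (nat multiset \<Rightarrow> complex)" where
  "D_op n f = (\<lambda>mu. \<Sum>lam\<in>partitions n. f lam * of_real (down_prob lam mu))"

definition U_op :: "real \<Rightarrow> real \<Rightarrow> nat \<Rightarrow> (nat multiset \<Rightarrow> complex) \<Rightarrow> (nat multiset \<Rightarrow> complex)" where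
  "U_op \<theta> \<alpha> n f = (\<lambda>mu. \<Sum>lam\<in>partitions n. f lam * of_real (up_prob \<theta> \<alpha> lam mu))"

definition UD_op :: "real \<Rightarrow> real \<Rightarrow> nat \<Rightarrow> (nat multiset \<Rightarrow> complex) \<Rightarrow> (nat multiset \<Rightarrow> complex)" where
  "UD_op \<theta> \<alpha> n = U_op \<theta> \<alpha> (n - 1) \<circ> D_op n"

text \<open>Matrix of an operator in the basis of partitions listed in the order \<open>ps\<close>; column \<open>j\<close> holds
  the coordinates of the image of the \<open>j\<close>-th basis vector.\<close>

definition matrix_wrt ::
  "nat multiset list \<Rightarrow> ((nat multiset \<Rightarrow> complex) \<Rightarrow> (nat multiset \<Rightarrow> complex)) \<Rightarrow> complex mat" where
  "matrix_wrt ps T = mat (length ps) (length ps) (\<lambda>(i, j). T (basis_vec (ps ! j)) (ps ! i))"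

text \<open>The sums over \<^term>\<open>partitions n\<close> and its cardinality are genuine.\<close>

lemma finite_partitions: "finite (partitions n)"
proof (rule finite_subset)
  show "partitions n \<subseteq> mset ` {xs. set xs \<subseteq> {..n} \<and> length xs \<le> n}"
  proof
    fix lam assume "lam \<in> partitions n"
    then have pos: "0 \<notin># lam" and sm: "sum_mset lam = n"
      by (auto simp: partitions_def)
    have le: "j \<le> n" if "j \<in># lam" for j
      using sm that by (auto dest!: multi_member_split)
    have "size lam \<le> sum_mset lam"
      using pos by (induction lam) auto
    moreover obtain xs where "lam = mset xs"
      by (metis ex_mset)
    ultimately show "lam \<in> mset ` {xs. set xs \<subseteq> {..n} \<and> length xs \<le> n}"
      using le sm by auto
  qed
  show "finite (mset ` {xs. set xs \<subseteq> {..n} \<and> length xs \<le> n})"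
    by (intro finite_imageI finite_lists_length_le) simp
qed

lemma num_partitions_0: "num_partitions 0 = 1"
proof -
  have "partitions 0 = {{#}}"
    by (auto simp: partitions_def) (metis multiset_nonemptyE)
  then show ?thesis
    by (simp add: num_partitions_def)
qed

end

theory Submission
  imports Defs
begin

text \<open>Rescale the down and up steps so that no \<open>n\<close>-dependent denominators remain. Then the
  commutator of the two steps on level \<open>n\<close> is the scalar \<open>\<theta> + 2n\<close>, so up to a shift and a scaling
  the down-up walk on level \<open>n + 1\<close> is the product \<open>AB\<close> of two rectangular matrices whose other
  product \<open>BA\<close> is the down-up walk on level \<open>n\<close>. As \<open>AB\<close> and \<open>BA\<close> have the same
  characteristic polynomial up to a power of the indeterminate, each level inherits the shifted
  eigenvalues of the level below and gains \<open>0\<close> with multiplicity \<open>p(n + 1) - p(n)\<close>.\<close>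

section \<open>Characteristic polynomials\<close>

lemma char_poly_four_block_mat_upper_right_zero:
  fixes A :: "'a :: idom mat"
  assumes A: "A \<in> carrier_mat n n" and C: "C \<in> carrier_mat m n" and D: "D \<in> carrier_mat m m"
  shows "char_poly (four_block_mat A (0\<^sub>m n m) C D) = char_poly A * char_poly D"
proof -
  have "char_poly_matrix (four_block_mat A (0\<^sub>m n m) C D) =
    four_block_mat (char_poly_matrix A) (0\<^sub>m n m) (map_mat (\<lambda>a. [:- a:]) C) (char_poly_matrix D)"
    by (rule eq_matI) (use A C D in \<open>auto simp: char_poly_matrix_def\<close>)
  then show ?thesis
    unfolding char_poly_def
    using A C D by (simp add: det_four_block_mat_upper_right_zero[of _ n _ m])
qed

lemma char_poly_zero_mat: "char_poly (0\<^sub>m n n :: 'a :: comm_ring_1 mat) = [:0, 1:] ^ n"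
proof -
  have "diag_mat (0\<^sub>m n n :: 'a mat) = replicate n 0"
    by (rule nth_equalityI) (simp_all add: diag_mat_def)
  then show ?thesis
    by (subst char_poly_upper_triangular[of _ n]) (auto simp: upper_triangular_def)
qed

text \<open>Conjugating by the unipotent block matrix \<open>P\<close> with \<open>A\<close> in its
  upper right corner carries \<open>T\<close> to \<open>S\<close>. Both are block triangular: the
  diagonal blocks of \<open>S\<close> are \<open>A * B\<close> and 0, those of \<open>T\<close> are
  0 and \<open>B * A\<close>, and each zero block contributes a power of the indeterminate.\<close>

lemma char_poly_mult_commute:
  fixes A B :: "'a :: idom mat"
  assumes A: "A \<in> carrier_mat p q" and B: "B \<in> carrier_mat q p"
  shows "char_poly (A * B) * [:0, 1:] ^ q = char_poly (B * A) * [:0, 1:] ^ p"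
proof -
  define S where "S = four_block_mat (A * B) (0\<^sub>m p q) B (0\<^sub>m q q)"
  define T where "T = four_block_mat (0\<^sub>m p p) (0\<^sub>m p q) B (B * A)"
  define P where "P = four_block_mat (1\<^sub>m p) A (0\<^sub>m q p) (1\<^sub>m q)"
  define Q where "Q = four_block_mat (1\<^sub>m p) (- A) (0\<^sub>m q p) (1\<^sub>m q)"
  have carrier: "{S, T, P, Q} \<subseteq> carrier_mat (p + q) (p + q)"
    using A B by (auto simp: S_def T_def P_def Q_def)
  have r_inv: "A + - A = 0\<^sub>m p q" and l_inv: "- A + A = 0\<^sub>m p q"
    using A by (intro eq_matI; simp)+
  have inv: "P * Q = 1\<^sub>m (p + q)" "Q * P = 1\<^sub>m (p + q)"
    unfolding P_def Q_def
    using A by (subst mult_four_block_mat[of _ p p _ q _ q _ _ p _ q]; simp add: r_inv l_inv del: uminus_mult_right_mat)+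
  have PT: "P * T = four_block_mat (A * B) (A * (B * A)) B (B * A)"
    unfolding P_def T_def
    using A B by (subst mult_four_block_mat[of _ p p _ q _ q _ _ p _ q]) auto
  have "S = P * T * Q"
    unfolding PT S_def Q_def
    using A B by (subst mult_four_block_mat[of _ p p _ q _ q _ _ p _ q])
      (auto simp: assoc_mult_mat[of A p q B p A q])
  then have "similar_mat S T"
    using carrier inv by (intro similar_matI) auto
  then have "char_poly S = char_poly T"
    by (rule char_poly_similar)
  then show ?thesis
    unfolding S_def T_def using A B
    by (simp add: char_poly_four_block_mat_upper_right_zero[of _ p _ q] char_poly_zero_mat mult.commute)
qed

text \<open>At every point x, det(x - (aN + c)) = a^n det((x - c)/a - N). Since \<open>n\<close> is
  the sum of the exponents, a^n can be distributed over the linear factors. In characteristic 0,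
  agreement at all points gives equality of polynomials.\<close>

lemma char_poly_affine:
  fixes N :: "'a :: field_char_0 mat"
  assumes N: "N \<in> carrier_mat n n" and "finite I" and "a \<noteq> 0"
    and char: "char_poly N = (\<Prod>i\<in>I. [:- e i, 1:] ^ m i)"
  shows "char_poly (a \<cdot>\<^sub>m N + c \<cdot>\<^sub>m 1\<^sub>m n) = (\<Prod>i\<in>I. [:- (a * e i + c), 1:] ^ m i)"
proof -
  have "n = degree (char_poly N)"
    using degree_monic_char_poly[OF N] by simp
  also have "\<dots> = (\<Sum>i\<in>I. m i)"
    unfolding char by (subst degree_prod_eq_sum_degree) (auto simp: degree_power_eq)
  finally have n: "n = (\<Sum>i\<in>I. m i)" .
  have M: "a \<cdot>\<^sub>m N + c \<cdot>\<^sub>m 1\<^sub>m n \<in> carrier_mat n n"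
    using N by simp
  have "poly (char_poly (a \<cdot>\<^sub>m N + c \<cdot>\<^sub>m 1\<^sub>m n)) x = poly (\<Prod>i\<in>I. [:- (a * e i + c), 1:] ^ m i) x"
    for x
  proof -
    have shift: "a * ((x - c) / a - e i) = x - (a * e i + c)" for i
      using \<open>a \<noteq> 0\<close> by (simp add: field_simps)
    have "- char_matrix (a \<cdot>\<^sub>m N + c \<cdot>\<^sub>m 1\<^sub>m n) x = a \<cdot>\<^sub>m (- char_matrix N ((x - c) / a))"
      using N \<open>a \<noteq> 0\<close> by (intro eq_matI) (auto simp: char_matrix_def field_simps)
    then have "poly (char_poly (a \<cdot>\<^sub>m N + c \<cdot>\<^sub>m 1\<^sub>m n)) x = a ^ n * poly (char_poly N) ((x - c) / a)"
      using N by (simp add: char_poly_matrix[OF M] char_poly_matrix[OF N] char_matrix_def)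
    also have "\<dots> = (\<Prod>i\<in>I. (a * ((x - c) / a - e i)) ^ m i)"
      by (simp add: char n poly_prod power_sum power_mult_distrib prod.distrib)
    also have "\<dots> = poly (\<Prod>i\<in>I. [:- (a * e i + c), 1:] ^ m i) x"
      by (simp add: poly_prod shift) (simp add: algebra_simps)
    finally show ?thesis .
  qed
  then show ?thesis
    by (simp add: poly_eq_poly_eq_iff[symmetric] fun_eq_iff)
qed

lemma order_prod_linear_powers:
  fixes e :: "'b \<Rightarrow> 'a :: idom"
  assumes "finite I" and "inj_on e I" and "k \<in> I"
  shows "order (e k) (\<Prod>i\<in>I. [:- e i, 1:] ^ m i) = m k"
proof -
  have nz: "(\<Prod>i\<in>I. [:- e i, 1:] ^ m i) \<noteq> 0"
    using assms(1) by simp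
  have split: "(\<Prod>i\<in>I. [:- e i, 1:] ^ m i) =
      [:- e k, 1:] ^ m k * (\<Prod>i\<in>I - {k}. [:- e i, 1:] ^ m i)"
    using assms by (simp add: prod.remove)
  have "poly (\<Prod>i\<in>I - {k}. [:- e i, 1:] ^ m i) (e k) \<noteq> 0"
    using assms by (auto simp: poly_prod inj_on_def)
  then show ?thesis
    using nz unfolding split by (subst order_mult) (simp_all add: order_power_n_n order_0I)
qed

section \<open>The commutation relation\<close>

text \<open>The unnormalised steps act on functions of partitions, dually to their action on formal
  combinations of partitions.\<close>

definition down_sum :: "(nat multiset \<Rightarrow> real) \<Rightarrow> nat multiset \<Rightarrow> real" where
  "down_sum g lam = (\<Sum>j\<in>#lam. real j * g (remove_box j lam))"

definition up_sum :: "real \<Rightarrow> real \<Rightarrow> (nat multiset \<Rightarrow> real) \<Rightarrow> nat multiset \<Rightarrow> real" where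
  "up_sum \<theta> \<alpha> g lam =
     (\<Sum>k\<in>#lam. (real k - \<alpha>) * g (add_box k lam)) + (\<theta> + \<alpha> * real (size lam)) * g (add_mset 1 lam)"

lemma sum_mset_subtractf:
  fixes f g :: "'a \<Rightarrow> 'b :: ab_group_add"
  shows "(\<Sum>k\<in>#M. f k - g k) = (\<Sum>k\<in>#M. f k) - (\<Sum>k\<in>#M. g k)"
  by (induction M) simp_all

text \<open>Both sides sum over ordered pairs of different occurrences of elements of
  \<open>M\<close>; each is the full double sum minus its diagonal.\<close>

lemma sum_mset_diff_swap:
  fixes f :: "'a \<Rightarrow> 'a \<Rightarrow> 'b :: ab_group_add"
  shows "(\<Sum>k\<in>#M. \<Sum>j\<in>#M - {#k#}. f k j) = (\<Sum>j\<in>#M. \<Sum>k\<in>#M - {#j#}. f k j)"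
proof -
  have diff: "(\<Sum>j\<in>#M - {#k#}. h j) = (\<Sum>j\<in>#M. h j) - h k" if "k \<in># M" for k and h :: "'a \<Rightarrow> 'b"
    using that by (auto dest!: multi_member_split)
  have "(\<Sum>k\<in>#M. \<Sum>j\<in>#M - {#k#}. f k j) = (\<Sum>k\<in>#M. (\<Sum>j\<in>#M. f k j) - f k k)"
    by (intro arg_cong[of _ _ sum_mset] image_mset_cong) (simp add: diff)
  also have "\<dots> = (\<Sum>k\<in>#M. (\<Sum>j\<in>#M. f j k) - f k k)"
    using sum_mset.swap[of f M M] by (simp add: sum_mset_subtractf)
  also have "\<dots> = (\<Sum>j\<in>#M. \<Sum>k\<in>#M - {#j#}. f k j)"
    by (intro arg_cong[of _ _ sum_mset] image_mset_cong) (simp add: diff)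
  finally show ?thesis .
qed

text \<open>Moves on two different parts commute, so their contributions cancel. What remains are
  the moves that undo each other and return to \<open>lam\<close>; the difference of their weights
  is the scalar \<theta> + 2n.\<close>

lemma up_sum_down_sum:
  assumes "0 \<notin># lam"
  shows "up_sum \<theta> \<alpha> (down_sum g) lam =
    down_sum (up_sum \<theta> \<alpha> g) lam + (\<theta> + 2 * real (sum_mset lam)) * g lam"
proof -
  let ?both = "\<lambda>k j. (real k - \<alpha>) * real j * g (remove_box j (add_box k lam))"
  \<comment> \<open>The first summand takes back the box just added. \<open>lam - {#k#}\<close>
    drops one occurrence only, so other parts of the same size stay in the sum.\<close>
  have down_add_box: "down_sum g (add_box k lam) =
      real (k + 1) * g lam + (\<Sum>j\<in>#lam - {#k#}. real j * g (remove_box j (add_box k lam)))"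
    if "k \<in># lam" for k
  proof -
    obtain N where lam: "lam = add_mset k N"
      using \<open>k \<in># lam\<close> by (auto dest: multi_member_split)
    then have "k \<noteq> 0"
      using assms by auto
    then show ?thesis
      by (simp add: lam down_sum_def add_box_def remove_box_def)
  qed
  \<comment> \<open>For j = 1 the part disappears and the weight of a new part falls by \<alpha>.
    The resulting term -\<alpha> * g lam is exactly (j - 1 - \<alpha>) * g lam, so one formula
    covers all j.\<close>
  have up_remove_box: "up_sum \<theta> \<alpha> g (remove_box j lam) =
      (real j - 1 - \<alpha>) * g lam
      + (\<Sum>k\<in>#lam - {#j#}. (real k - \<alpha>) * g (remove_box j (add_box k lam)))
      + (\<theta> + \<alpha> * real (size lam)) * g (add_mset 1 (remove_box j lam))"
    if j: "j \<in># lam" for j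
  proof -
    obtain N where lam: "lam = add_mset j N"
      using \<open>j \<in># lam\<close> by (auto dest: multi_member_split)
    then have "j \<noteq> 0"
      using assms by auto
    have swap: "add_box k (remove_box j lam) = remove_box j (add_box k lam)" if "k \<in># N" for k
      using that by (auto dest!: multi_member_split simp: lam add_box_def remove_box_def)
    show ?thesis
    proof (cases "j = 1")
      case True
      then have "remove_box j lam = N"
        by (simp add: lam remove_box_def)
      then show ?thesis
        using True swap
        by (simp add: lam up_sum_def algebra_simps cong: multiset.map_cong)
    next
      case False
      then have rem: "remove_box j lam = add_mset (j - 1) N"
        by (simp add: lam remove_box_def)
      have "add_box (j - 1) (remove_box j lam) = lam"
        using \<open>j \<noteq> 0\<close> by (simp add: lam rem[unfolded lam] add_box_def)
      then show ?thesis
        using \<open>j \<noteq> 0\<close> swap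
        by (simp add: lam rem[unfolded lam] up_sum_def of_nat_diff cong: multiset.map_cong)
    qed
  qed
  have down_add: "down_sum g (add_mset 1 lam) =
      g lam + (\<Sum>j\<in>#lam. real j * g (add_mset 1 (remove_box j lam)))"
  proof -
    have "remove_box j (add_mset 1 lam) = add_mset 1 (remove_box j lam)" if "j \<in># lam" for j
      using that by (auto dest!: multi_member_split simp: remove_box_def)
    then show ?thesis
      by (simp add: down_sum_def remove_box_def[of "Suc 0"] cong: multiset.map_cong)
  qed
  have up: "up_sum \<theta> \<alpha> (down_sum g) lam =
      (\<Sum>k\<in>#lam. (real k - \<alpha>) * real (k + 1)) * g lam
      + (\<Sum>k\<in>#lam. \<Sum>j\<in>#lam - {#k#}. ?both k j)
      + (\<theta> + \<alpha> * real (size lam)) * (g lam + (\<Sum>j\<in>#lam. real j * g (add_mset 1 (remove_box j lam))))"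
  proof -
    have "(\<Sum>k\<in>#lam. (real k - \<alpha>) * down_sum g (add_box k lam)) =
        (\<Sum>k\<in>#lam. (real k - \<alpha>) * real (k + 1) * g lam + (\<Sum>j\<in>#lam - {#k#}. ?both k j))"
      by (intro arg_cong[of _ _ sum_mset] image_mset_cong)
        (simp add: down_add_box ring_distribs sum_mset_distrib_left image_mset.compositionality comp_def mult.assoc)
    then show ?thesis
      unfolding up_sum_def[of _ _ "down_sum g"] down_add
      by (simp only: sum_mset.distrib sum_mset_distrib_right)
  qed
  have down: "down_sum (up_sum \<theta> \<alpha> g) lam =
      (\<Sum>j\<in>#lam. real j * (real j - 1 - \<alpha>)) * g lam
      + (\<Sum>j\<in>#lam. \<Sum>k\<in>#lam - {#j#}. ?both k j)
      + (\<theta> + \<alpha> * real (size lam)) * (\<Sum>j\<in>#lam. real j * g (add_mset 1 (remove_box j lam)))"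
  proof -
    have "down_sum (up_sum \<theta> \<alpha> g) lam =
        (\<Sum>j\<in>#lam. real j * (real j - 1 - \<alpha>) * g lam + (\<Sum>k\<in>#lam - {#j#}. ?both k j)
          + (\<theta> + \<alpha> * real (size lam)) * (real j * g (add_mset 1 (remove_box j lam))))"
      unfolding down_sum_def
      by (intro arg_cong[of _ _ sum_mset] image_mset_cong)
        (simp add: up_remove_box distrib_left sum_mset_distrib_left image_mset.compositionality
          comp_def mult_ac)
    then show ?thesis
      by (simp only: sum_mset.distrib sum_mset_distrib_right sum_mset_distrib_left)
  qed
  have swap: "(\<Sum>k\<in>#lam. \<Sum>j\<in>#lam - {#k#}. ?both k j) = (\<Sum>j\<in>#lam. \<Sum>k\<in>#lam - {#j#}. ?both k j)"
    by (rule sum_mset_diff_swap)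
  \<comment> \<open>Each part k contributes (k - \<alpha>)(k + 1) - k(k - 1 - \<alpha>) = 2k -
    \<alpha>. The total of the terms -\<alpha> cancels against the \<alpha> l(\<lambda>) in the
    weight of a new part, leaving \<theta> + 2n.\<close>
  have weights: "(\<Sum>k\<in>#lam. (real k - \<alpha>) * real (k + 1)) =
      (\<Sum>j\<in>#lam. real j * (real j - 1 - \<alpha>)) + 2 * real (sum_mset lam) - \<alpha> * real (size lam)"
    by (induction lam) (simp_all add: algebra_simps)
  have combine: "(y + 2 * s - t) * h + z + (\<theta> + t) * (h + r) = y * h + z + (\<theta> + t) * r + (\<theta> + 2 * s) * h"
    for y s t h z r :: real
    by (simp add: algebra_simps)
  show ?thesis
    unfolding up down swap weights by (rule combine)
qed

section \<open>Transition probabilities in terms of the unnormalised steps\<close>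

lemma sum_mset_conv_sum_count:
  fixes f :: "'a \<Rightarrow> 'b :: comm_semiring_1"
  shows "(\<Sum>j\<in>#M. f j) = (\<Sum>j\<in>set_mset M. of_nat (count M j) * f j)"
proof (induction M)
  case (add x M)
  have "(\<Sum>j\<in>set_mset M. of_nat (count M j) * f j) =
      (\<Sum>j\<in>insert x (set_mset M). of_nat (count M j) * f j)"
    by (rule sum.mono_neutral_left) (auto simp: not_in_iff)
  moreover have "of_nat (count (add_mset x M) j) * f j =
      (if j = x then f j else 0) + of_nat (count M j) * f j" for j
    by (simp add: distrib_right)
  ultimately show ?case
    using add by (simp add: sum.distrib del: count_add_mset)
qed simp

lemma remove_box_in_partitions:
  assumes "lam \<in> partitions (Suc n)" and "j \<in># lam"
  shows "remove_box j lam \<in> partitions n"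
  using assms by (auto simp: partitions_def remove_box_def dest!: multi_member_split)

lemma add_box_in_partitions:
  assumes "lam \<in> partitions n" and "k \<in># lam"
  shows "add_box k lam \<in> partitions (Suc n)"
  using assms by (auto simp: partitions_def add_box_def dest!: multi_member_split)

lemma add_mset_1_in_partitions:
  assumes "lam \<in> partitions n"
  shows "add_mset 1 lam \<in> partitions (Suc n)"
  using assms by (simp add: partitions_def)

text \<open>Each part size of \<open>lam\<close> leads to exactly one partition of \<open>n\<close>,
  so the sum over targets regroups into a sum over part sizes.\<close>

lemma sum_down_prob:
  assumes lam: "lam \<in> partitions (Suc n)"
  shows "(\<Sum>nu\<in>partitions n. down_prob lam nu * h nu) = down_sum h lam / real (Suc n)"
proof -
  have size: "sum_mset lam = Suc n"
    using lam by (simp add: partitions_def)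
  let ?w = "\<lambda>j. real j * real (count lam j) / real (sum_mset lam) * h (remove_box j lam)"
  have "(\<Sum>nu\<in>partitions n. down_prob lam nu * h nu) =
      (\<Sum>nu\<in>partitions n. \<Sum>j | j \<in># lam \<and> remove_box j lam = nu. ?w j)"
    unfolding down_prob_def sum_distrib_right by (intro sum.cong refl) auto
  also have "\<dots> = (\<Sum>j\<in>set_mset lam. ?w j)"
    using remove_box_in_partitions[OF lam] by (intro sum.group) (auto simp: finite_partitions)
  also have "\<dots> = down_sum h lam / real (Suc n)"
    unfolding down_sum_def sum_mset_conv_sum_count sum_divide_distrib size
    by (intro sum.cong) (simp_all add: field_simps)
  finally show ?thesis .
qed

lemma sum_up_prob:
  assumes lam: "lam \<in> partitions n"
  shows "(\<Sum>nu\<in>partitions (Suc n). up_prob \<theta> \<alpha> lam nu * h nu) = up_sum \<theta> \<alpha> h lam / (\<theta> + real n)"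
proof -
  have size: "sum_mset lam = n"
    using lam by (simp add: partitions_def)
  let ?w = "\<lambda>k. (real k - \<alpha>) * real (count lam k) / (\<theta> + real (sum_mset lam)) * h (add_box k lam)"
  let ?c = "(\<theta> + \<alpha> * real (size lam)) / (\<theta> + real (sum_mset lam))"
  have "(\<Sum>nu\<in>partitions (Suc n). up_prob \<theta> \<alpha> lam nu * h nu) =
      (\<Sum>nu\<in>partitions (Suc n). (\<Sum>k | k \<in># lam \<and> add_box k lam = nu. ?w k)
        + (if nu = add_mset 1 lam then ?c * h nu else 0))"
    unfolding up_prob_def distrib_right sum_distrib_right
    by (intro sum.cong arg_cong2[of _ _ _ _ "(+)"] refl) auto
  also have "\<dots> = (\<Sum>nu\<in>partitions (Suc n). \<Sum>k | k \<in># lam \<and> add_box k lam = nu. ?w k)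
      + ?c * h (add_mset 1 lam)"
    using add_mset_1_in_partitions[OF lam] by (simp add: sum.distrib finite_partitions)
  also have "(\<Sum>nu\<in>partitions (Suc n). \<Sum>k | k \<in># lam \<and> add_box k lam = nu. ?w k) =
      (\<Sum>k\<in>set_mset lam. ?w k)"
    using add_box_in_partitions[OF lam] by (intro sum.group) (auto simp: finite_partitions)
  also have "\<dots> = (\<Sum>k\<in>#lam. (real k - \<alpha>) * h (add_box k lam)) / (\<theta> + real n)"
    unfolding sum_mset_conv_sum_count sum_divide_distrib size
    by (intro sum.cong) (simp_all add: mult_ac)
  finally show ?thesis
    by (simp add: up_sum_def size add_divide_distrib distrib_right)
qed

section \<open>The spectrum of the down-up walk\<close>

text \<open>The product of the two denominators: n of the down step and \<theta> + n - 1 of the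
  following up step. The claimed eigenvalues are 1 -
  \<open>level_weight \<theta> i / level_weight \<theta> n\<close>.\<close>

definition level_weight :: "real \<Rightarrow> nat \<Rightarrow> real" where
  "level_weight \<theta> n = real n * (\<theta> + real n - 1)"

text \<open>The increment from level n is \<theta> + 2n, the scalar of the commutation relation.
  Monotonicity later makes the claimed eigenvalues pairwise distinct.\<close>

lemma level_weight_strict_mono:
  assumes "\<theta> > 0"
  shows "strict_mono (level_weight \<theta>)"
proof (rule strict_mono_Suc_iff[THEN iffD2], intro allI)
  fix n
  have "level_weight \<theta> (Suc n) = level_weight \<theta> n + \<theta> + 2 * real n"
    by (simp add: level_weight_def algebra_simps)
  then show "level_weight \<theta> n < level_weight \<theta> (Suc n)"
    using assms by simp
qed

text \<open>Evaluating the dual steps on indicator functions reads off matrix entries.\<close>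

abbreviation point_mass :: "nat multiset \<Rightarrow> nat multiset \<Rightarrow> real" where
  "point_mass mu \<equiv> \<lambda>lam. of_bool (lam = mu)"

lemma down_sum_cong:
  assumes "lam \<in> partitions (Suc n)" and "\<And>nu. nu \<in> partitions n \<Longrightarrow> g nu = h nu"
  shows "down_sum g lam = down_sum h lam"
  using assms remove_box_in_partitions[OF assms(1)]
  by (simp add: down_sum_def cong: multiset.map_cong)

lemma up_sum_cong:
  assumes "lam \<in> partitions n" and "\<And>nu. nu \<in> partitions (Suc n) \<Longrightarrow> g nu = h nu"
  shows "up_sum \<theta> \<alpha> g lam = up_sum \<theta> \<alpha> h lam"
  using assms add_box_in_partitions[OF assms(1)] add_mset_1_in_partitions[OF assms(1)]
  by (simp add: up_sum_def cong: multiset.map_cong)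

lemma scaled_down_prob:
  assumes "lam \<in> partitions (Suc n)" and "mu \<in> partitions n"
  shows "real (Suc n) * down_prob lam mu = down_sum (point_mass mu) lam"
proof -
  have "(\<Sum>nu\<in>partitions n. down_prob lam nu * point_mass mu nu) = down_prob lam mu"
    using assms by (simp add: of_bool_def finite_partitions if_distrib cong: if_cong)
  then show ?thesis
    unfolding sum_down_prob[OF assms(1)] by (simp add: field_simps)
qed

lemma scaled_up_prob:
  assumes "\<theta> > 0" and "lam \<in> partitions n" and "mu \<in> partitions (Suc n)"
  shows "(\<theta> + real n) * up_prob \<theta> \<alpha> lam mu = up_sum \<theta> \<alpha> (point_mass mu) lam"
proof -
  have "(\<Sum>nu\<in>partitions (Suc n). up_prob \<theta> \<alpha> lam nu * point_mass mu nu) = up_prob \<theta> \<alpha> lam mu"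
    using assms by (simp add: of_bool_def finite_partitions if_distrib cong: if_cong)
  moreover have "\<theta> + real n > 0"
    using assms(1) by simp
  ultimately show ?thesis
    unfolding sum_up_prob[OF assms(2)] by (simp add: field_simps)
qed

lemma UD_op_basis_vec:
  assumes "lam \<in> partitions n"
  shows "UD_op \<theta> \<alpha> n (basis_vec lam) mu =
    of_real (\<Sum>nu\<in>partitions (n - 1). down_prob lam nu * up_prob \<theta> \<alpha> nu mu)"
proof -
  have "D_op n (basis_vec lam) nu = of_real (down_prob lam nu)" for nu
    using assms by (simp add: D_op_def basis_vec_def finite_partitions if_distrib if_distribR cong: if_cong)
  then show ?thesis
    by (simp add: UD_op_def U_op_def)
qed

lemma scaled_UD_entry:
  assumes "\<theta> > 0" and lam: "lam \<in> partitions n" and mu: "mu \<in> partitions n"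
  shows "level_weight \<theta> n * (\<Sum>nu\<in>partitions (n - 1). down_prob lam nu * up_prob \<theta> \<alpha> nu mu) =
    down_sum (up_sum \<theta> \<alpha> (point_mass mu)) lam"
proof (cases n)
  \<comment> \<open>Here \<open>n - 1\<close> truncates to 0, but the level weight on the left
    vanishes and the sum over the empty partition on the right is empty.\<close>
  case 0
  then have "lam = {#}"
    using lam by (cases lam) (auto simp: partitions_def)
  then show ?thesis
    by (simp add: 0 level_weight_def down_sum_def)
next
  case (Suc m)
  have "level_weight \<theta> n * (\<Sum>nu\<in>partitions m. down_prob lam nu * up_prob \<theta> \<alpha> nu mu) =
      real (Suc m) * (\<Sum>nu\<in>partitions m. down_prob lam nu * ((\<theta> + real m) * up_prob \<theta> \<alpha> nu mu))"
    by (simp add: Suc level_weight_def sum_distrib_left mult_ac)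
  also have "\<dots> = down_sum (\<lambda>nu. (\<theta> + real m) * up_prob \<theta> \<alpha> nu mu) lam"
    using lam by (subst sum_down_prob) (simp_all add: Suc)
  also have "\<dots> = down_sum (up_sum \<theta> \<alpha> (point_mass mu)) lam"
    using lam mu assms(1) by (intro down_sum_cong[of _ m]) (simp_all add: Suc scaled_up_prob)
  finally show ?thesis
    by (simp add: Suc)
qed

text \<open>The opposite composite, up from level n and then down. The commutation relation will
  turn it into the walk of \<open>scaled_UD_entry\<close> plus a scalar.\<close>

lemma scaled_DU_entry:
  assumes "\<theta> > 0" and lam: "lam \<in> partitions n" and mu: "mu \<in> partitions n"
  shows "level_weight \<theta> (Suc n) *
      (\<Sum>nu\<in>partitions (Suc n). up_prob \<theta> \<alpha> lam nu * down_prob nu mu) =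
    up_sum \<theta> \<alpha> (down_sum (point_mass mu)) lam"
proof -
  have "level_weight \<theta> (Suc n) *
      (\<Sum>nu\<in>partitions (Suc n). up_prob \<theta> \<alpha> lam nu * down_prob nu mu) =
      (\<theta> + real n) * (\<Sum>nu\<in>partitions (Suc n). up_prob \<theta> \<alpha> lam nu * (real (Suc n) * down_prob nu mu))"
    by (simp add: level_weight_def sum_distrib_left mult_ac)
  also have "\<dots> = up_sum \<theta> \<alpha> (\<lambda>nu. real (Suc n) * down_prob nu mu) lam"
    using lam assms(1) by (subst sum_up_prob) (simp_all add: add_pos_nonneg)
  also have "\<dots> = up_sum \<theta> \<alpha> (down_sum (point_mass mu)) lam"
    using lam mu by (intro up_sum_cong[of _ n]) (simp_all only: scaled_down_prob)
  finally show ?thesis .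
qed

section \<open>Multiplicities\<close>

text \<open>A natural number, so that it can serve as an exponent.\<close>

definition new_partitions :: "nat \<Rightarrow> nat" where
  "new_partitions i = nat (num_partitions (int i) - num_partitions (int i - 1))"

text \<open>Adjoining a part 1 is injective, so p(n) \<le> p(n + 1) and the conversion by
  \<open>nat\<close> loses nothing.\<close>

lemma card_partitions_Suc: "card (partitions (Suc n)) = card (partitions n) + new_partitions (Suc n)"
proof -
  have "card (partitions n) \<le> card (partitions (Suc n))"
    by (rule card_inj_on_le[of "add_mset 1"])
      (auto intro!: inj_onI simp: finite_partitions add_mset_1_in_partitions[simplified])
  then show ?thesis
    by (simp add: new_partitions_def num_partitions_def nat_add_distrib)
qed

lemma int_new_partitions:
  "int (new_partitions i) = num_partitions (int i) - num_partitions (int i - 1)"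
proof (cases i)
  case 0
  then show ?thesis
    by (simp add: new_partitions_def num_partitions_0) (simp add: num_partitions_def)
next
  case (Suc n)
  then show ?thesis
    using card_partitions_Suc[of n] by (simp add: num_partitions_def nat_add_distrib)
qed

section \<open>Recursion of the characteristic polynomial over the levels\<close>

abbreviation scaled_walk :: "real \<Rightarrow> real \<Rightarrow> nat \<Rightarrow> nat multiset list \<Rightarrow> complex mat" where
  "scaled_walk \<theta> \<alpha> n ps \<equiv> of_real (level_weight \<theta> n) \<cdot>\<^sub>m matrix_wrt ps (UD_op \<theta> \<alpha> n)"

lemma sum_nth_conv_sum_set:
  assumes "distinct xs"
  shows "(\<Sum>k = 0..<length xs. f (xs ! k)) = (\<Sum>x\<in>set xs. f x)"
  by (rule sum.reindex_bij_betw) (use assms in \<open>auto intro!: bij_betw_nth\<close>)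

lemma char_poly_scaled_walk_Suc:
  fixes \<theta> \<alpha> :: real
  assumes "\<theta> > 0"
    and ps: "distinct ps" "set ps = partitions (Suc n)"
    and qs: "distinct qs" "set qs = partitions n"
  shows "char_poly (scaled_walk \<theta> \<alpha> (Suc n) ps) =
    char_poly (scaled_walk \<theta> \<alpha> n qs + of_real (\<theta> + 2 * real n) \<cdot>\<^sub>m 1\<^sub>m (length qs))
      * [:0, 1:] ^ new_partitions (Suc n)"
proof -
  \<comment> \<open>\<open>A\<close> is the up step from level n and \<open>B\<close> the down step
    from level n + 1, with columns indexed by the source. Their scalings \<theta> + n and n + 1
    multiply to \<open>level_weight \<theta> (Suc n)\<close>.\<close>
  define A :: "complex mat" where
    "A = mat (length ps) (length qs) (\<lambda>(i, j). of_real ((\<theta> + real n) * up_prob \<theta> \<alpha> (qs ! j) (ps ! i)))"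
  define B :: "complex mat" where
    "B = mat (length qs) (length ps) (\<lambda>(i, j). of_real (real (Suc n) * down_prob (ps ! j) (qs ! i)))"
  have A: "A \<in> carrier_mat (length ps) (length qs)" and B: "B \<in> carrier_mat (length qs) (length ps)"
    by (simp_all add: A_def B_def)
  have ps_nth: "ps ! i \<in> partitions (Suc n)" if "i < length ps" for i
    using that ps(2) nth_mem by blast
  have qs_nth: "qs ! i \<in> partitions n" if "i < length qs" for i
    using that qs(2) nth_mem by blast
  have AB: "A * B = scaled_walk \<theta> \<alpha> (Suc n) ps"
  proof (rule eq_matI)
    fix i j
    assume "i < dim_row (scaled_walk \<theta> \<alpha> (Suc n) ps)" "j < dim_col (scaled_walk \<theta> \<alpha> (Suc n) ps)"
    then have ij: "i < length ps" "j < length ps"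
      by (simp_all add: matrix_wrt_def)
    have "(A * B) $$ (i, j) = of_real (\<Sum>k = 0..<length qs.
        (\<theta> + real n) * up_prob \<theta> \<alpha> (qs ! k) (ps ! i) * (real (Suc n) * down_prob (ps ! j) (qs ! k)))"
      using ij by (simp add: A_def B_def scalar_prod_def)
    also have "\<dots> = of_real (\<Sum>nu\<in>partitions n.
        (\<theta> + real n) * up_prob \<theta> \<alpha> nu (ps ! i) * (real (Suc n) * down_prob (ps ! j) nu))"
      by (simp only: sum_nth_conv_sum_set[OF qs(1), symmetric] qs(2)[symmetric])
    also have "\<dots> = scaled_walk \<theta> \<alpha> (Suc n) ps $$ (i, j)"
      using ij ps_nth
      by (simp add: matrix_wrt_def UD_op_basis_vec level_weight_def sum_distrib_left mult_ac)
    finally show "(A * B) $$ (i, j) = scaled_walk \<theta> \<alpha> (Suc n) ps $$ (i, j)" .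
  qed (simp_all add: A_def B_def matrix_wrt_def)
  have BA: "B * A = scaled_walk \<theta> \<alpha> n qs + of_real (\<theta> + 2 * real n) \<cdot>\<^sub>m 1\<^sub>m (length qs)" (is "_ = ?C")
  proof (rule eq_matI)
    fix i j
    assume "i < dim_row ?C" "j < dim_col ?C"
    then have ij: "i < length qs" "j < length qs"
      by simp_all
    have "(B * A) $$ (i, j) = of_real (\<Sum>k = 0..<length ps.
        (real (Suc n) * down_prob (ps ! k) (qs ! i)) * ((\<theta> + real n) * up_prob \<theta> \<alpha> (qs ! j) (ps ! k)))"
      using ij by (simp add: A_def B_def scalar_prod_def)
    also have "\<dots> = of_real (\<Sum>nu\<in>partitions (Suc n).
        (real (Suc n) * down_prob nu (qs ! i)) * ((\<theta> + real n) * up_prob \<theta> \<alpha> (qs ! j) nu))"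
      by (simp only: sum_nth_conv_sum_set[OF ps(1), symmetric] ps(2)[symmetric])
    also have "\<dots> = of_real (level_weight \<theta> (Suc n) *
        (\<Sum>nu\<in>partitions (Suc n). up_prob \<theta> \<alpha> (qs ! j) nu * down_prob nu (qs ! i)))"
      by (simp add: level_weight_def sum_distrib_left mult_ac)
    also have "\<dots> = of_real (up_sum \<theta> \<alpha> (down_sum (point_mass (qs ! i))) (qs ! j))"
      using assms(1) ij qs_nth by (simp only: scaled_DU_entry)
    \<comment> \<open>The commutation relation at the indicator of \<open>qs ! i\<close>: as
      \<open>qs\<close> is distinct, the scalar term appears exactly on the diagonal.\<close>
    also have "\<dots> = of_real (down_sum (up_sum \<theta> \<alpha> (point_mass (qs ! i))) (qs ! j)
        + (\<theta> + 2 * real n) * of_bool (i = j))"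
      using ij qs_nth[of j] qs(1)
      by (subst up_sum_down_sum) (auto simp: partitions_def nth_eq_iff_index_eq)
    also have "\<dots> = ?C $$ (i, j)"
      using ij qs_nth
      by (simp add: matrix_wrt_def UD_op_basis_vec scaled_UD_entry[OF assms(1) qs_nth qs_nth, symmetric]
          del: of_real_sum One_nat_def)
    finally show "(B * A) $$ (i, j) = ?C $$ (i, j)" .
  qed (simp_all add: A_def B_def)
  \<comment> \<open>This splits the larger power of the indeterminate so that its
    \<open>length qs\<close>-th power cancels from both sides.\<close>
  have lengths: "length ps = length qs + new_partitions (Suc n)"
    using ps qs card_partitions_Suc[of n] by (metis distinct_card)
  have "char_poly (A * B) * [:0, 1:] ^ length qs =
      char_poly (B * A) * [:0, 1:] ^ new_partitions (Suc n) * [:0, 1:] ^ length qs"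
    unfolding char_poly_mult_commute[OF A B] lengths power_add by (simp add: mult_ac)
  then have "char_poly (A * B) = char_poly (B * A) * [:0, 1:] ^ new_partitions (Suc n)"
    by simp
  then show ?thesis
    by (simp only: AB BA)
qed

text \<open>Induction on the level: the inherited eigenvalues move by \<theta> + 2n, the increment
  of \<open>level_weight\<close>, and the new eigenvalue 0 is the factor with i = n + 1.\<close>

lemma char_poly_scaled_walk:
  assumes "\<theta> > 0" and "distinct ps" and "set ps = partitions n"
  shows "char_poly (scaled_walk \<theta> \<alpha> n ps) =
    (\<Prod>i\<le>n. [:- of_real (level_weight \<theta> n - level_weight \<theta> i), 1:] ^ new_partitions i)"
  using assms(2,3)
proof (induction n arbitrary: ps)
  case 0
  have "length ps = card (partitions 0)"
    using 0 by (metis distinct_card)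
  then have length: "length ps = new_partitions 0"
    by (simp add: new_partitions_def num_partitions_def)
  \<comment> \<open>On level 0 the scaling factor is 0, which gives the single eigenvalue 0 of the
    case i = 0.\<close>
  have "scaled_walk \<theta> \<alpha> 0 ps = 0\<^sub>m (length ps) (length ps)"
    by (rule eq_matI) (simp_all add: level_weight_def matrix_wrt_def)
  then show ?case
    by (simp add: char_poly_zero_mat length)
next
  case (Suc n)
  obtain qs where qs: "distinct qs" "set qs = partitions n"
    using finite_distinct_list[OF finite_partitions] by blast
  have "matrix_wrt qs T \<in> carrier_mat (length qs) (length qs)" for T
    by (simp add: matrix_wrt_def)
  \<comment> \<open>The scalar 1 only brings the shifted matrix into the shape of
    \<open>char_poly_affine\<close>.\<close>
  then have "char_poly (1 \<cdot>\<^sub>m scaled_walk \<theta> \<alpha> n qs + of_real (\<theta> + 2 * real n) \<cdot>\<^sub>m 1\<^sub>m (length qs)) =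
      (\<Prod>i\<le>n. [:- (1 * of_real (level_weight \<theta> n - level_weight \<theta> i) + of_real (\<theta> + 2 * real n)), 1:]
        ^ new_partitions i)"
    by (intro char_poly_affine Suc.IH[OF qs]) simp_all
  moreover have "1 * of_real (level_weight \<theta> n - level_weight \<theta> i) + of_real (\<theta> + 2 * real n) =
      (of_real (level_weight \<theta> (Suc n) - level_weight \<theta> i) :: complex)" for i
    unfolding level_weight_def mult_1 of_real_add[symmetric] of_real_eq_iff by (simp add: algebra_simps)
  moreover have "1 \<cdot>\<^sub>m scaled_walk \<theta> \<alpha> n qs = scaled_walk \<theta> \<alpha> n qs"
    by (rule eq_matI) simp_all
  ultimately show ?case
    unfolding char_poly_scaled_walk_Suc[OF assms(1) Suc.prems qs] by (simp only: atMost_Suc) simp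
qed

text \<open>Multiplicity is algebraic: the order of the root in the characteristic polynomial. An
  index with p(i) = p(i - 1), such as i = 1, gives no eigenvalue.\<close>

theorem corollary7p2:
  fixes \<theta> \<alpha> :: real and n :: nat and ps :: "nat multiset list"
    and M :: "complex mat" and ev :: "nat \<Rightarrow> complex"
  assumes "\<theta> > 0" and "0 \<le> \<alpha>" and "\<alpha> < 1" and "n \<ge> 1"
    and "distinct ps" and "set ps = partitions n"
  defines "M \<equiv> matrix_wrt ps (UD_op \<theta> \<alpha> n)"
    and "ev \<equiv> \<lambda>i. complex_of_real
           (1 - real i * (\<theta> + real i - 1) / (real n * (\<theta> + real n - 1)))"
  shows "{x. eigenvalue M x} =
           {ev i | i. i \<le> n \<and> num_partitions (int i) - num_partitions (int i - 1) > 0}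
         \<and> (\<forall>i\<le>n. int (order (ev i) (char_poly M)) =
              num_partitions (int i) - num_partitions (int i - 1))"
proof -
  have M: "M \<in> carrier_mat (length ps) (length ps)"
    by (simp add: M_def matrix_wrt_def)
  define w where "w = level_weight \<theta> n"
  have "w > 0"
    using assms(1,4) by (simp add: w_def level_weight_def)
  \<comment> \<open>Undoing the scaling is the affine change with slope 1/w and shift 0, hence the
    form with \<open>+ 0\<close>.\<close>
  have ev: "ev i = of_real (inverse w) * of_real (w - level_weight \<theta> i) + 0" for i
    using \<open>w > 0\<close> unfolding ev_def w_def level_weight_def
    by (simp add: field_simps flip: of_real_mult)
  have "of_real (inverse w) \<cdot>\<^sub>m scaled_walk \<theta> \<alpha> n ps + 0 \<cdot>\<^sub>m 1\<^sub>m (length ps) = M"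
    using \<open>w > 0\<close> by (intro eq_matI) (simp_all add: M_def matrix_wrt_def w_def)
  moreover have "char_poly (of_real (inverse w) \<cdot>\<^sub>m scaled_walk \<theta> \<alpha> n ps + 0 \<cdot>\<^sub>m 1\<^sub>m (length ps)) =
      (\<Prod>i\<le>n. [:- (of_real (inverse w) * of_real (w - level_weight \<theta> i) + 0), 1:] ^ new_partitions i)"
    using \<open>w > 0\<close> M char_poly_scaled_walk[OF assms(1,5,6)] unfolding M_def w_def
    by (intro char_poly_affine) simp_all
  ultimately have char: "char_poly M = (\<Prod>i\<le>n. [:- ev i, 1:] ^ new_partitions i)"
    by (simp only: ev)
  \<comment> \<open>Distinct values \<open>ev i\<close> let the order of each be read off from a
    single factor.\<close>
  have "inj_on ev {..n}"
    using \<open>w > 0\<close> strict_mono_eq[OF level_weight_strict_mono[OF assms(1)]]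
    by (auto intro!: inj_onI simp: ev)
  then have order: "order (ev i) (char_poly M) = new_partitions i" if "i \<le> n" for i
    using that unfolding char by (intro order_prod_linear_powers) simp_all
  \<comment> \<open>A factor with exponent 0 is 1 and has no root, so only indices of positive
    multiplicity remain.\<close>
  have "{x. eigenvalue M x} = {ev i | i. i \<le> n \<and> new_partitions i > 0}"
    unfolding eigenvalue_root_char_poly[OF M] char by (auto simp: poly_prod)
  then show ?thesis
    using order by (simp add: flip: int_new_partitions)
qed

end
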